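(* Let $T$ be a random variable with $0\le T\le1$ a.s. Suppose $T_1,T_2,\ldots$ is an i.i.d. sample of $T$ and let $\{M_k^{\mu,-}\}_{k,\mu}$ and $\{M_k^{\mu,+}\}_{k,\mu}$ be a convex decreasing, respectively convex increasing, family of test supermartingales for the null hypotheses $\{H_0:\mathbf{E}(T)\le\mu\}_\mu$, respectively $\{H_0:\mathbf{E}(T)\ge\mu\}_\mu$. Let $p^-,p^+\ge0$, $p^-+p^+=1$, and $M_k^\mu=p^-M_k^{\mu,-}+p^+M_k^{\mu,+}$. Then: 1. For all $0<\mu<1$ the process $\{M_k^\mu\}_k$ is a test supermartingale for $H_0:\mathbf{E}(T)=\mu$. 2. Any realization of $\mu\mapsto M_k^\mu$ is a convex function. 3. Let $0<\alpha<1$. The region $R=\{\mu\mid\forall k: M_k^\mu<1/\alpha\}$ is a $(1-\alpha)$-confidence interval for $\mathbf{E}(T)$. Thus, for any $k$, $R_k=\{\mu\mid\forall n\le k: M_n^\mu<1/\alpha\}$ as well as $R'_k=\{\mu\mid M_k^\mu<1/\alpha\}$ are $(1-\alpha)$-confidence intervals for $\mathbf{E}(T)$. 4. When for the decreasing and increasing family the integrated families $$M_k^{\mu,-}=\int_0^1\prod_{i=1}^k\left((1-c)+c\,\frac{T_i}{\mu}\right)\pi^-(c)\,dc,\qquad M_k^{\mu,+}=\int_0^1\prod_{i=1}^k\left((1-c)+c\,\frac{1-T_i}{1-\mu}\right)\pi^+(c)\,dc$$ are used, where the test measures $\pi^-,\pi^+$ are probability densities on $[0,1]$ (determined independently of the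 sample), the confidence interval $R'_k$ contains the $k$-th sample average $\overline{t}_k=\frac1k\sum_{i=1}^k t_i$, where $t_1,\ldots,t_k$ are the observed values of $T_1,\ldots,T_k$.
   Context: Processes are indexed by times $k=0,1,2,\ldots$ and are adapted to a filtration $\{\mathcal{F}_k\}_k$, for instance the one generated by the sample, $\mathcal{F}_k=\sigma(T_1,\ldots,T_k)$ with $\mathcal{F}_0$ trivial. A process is positive if each of its variables is $\ge0$ a.s. A process $\{Y_k\}_{k\ge0}$ is a test supermartingale for a hypothesis $H_0$ if, whenever $H_0$ is satisfied, $\{Y_k\}_k$ is a positive (integrable) supermartingale and $\mathbf{E}(Y_0)>0$. A decreasing family of test supermartingales for $\{H_0:\mathbf{E}(T)\le\mu\}_\mu$ is a family $\{M_k^\mu\}_{k,\mu}$, $\mu>0$, such that for each $\mu$ the process $\{M_k^\mu\}_k$ is a test supermartingale for $H_0:\mathbf{E}(T)\le\mu$, and for every $k$ any realization of $\mu\mapsto M_k^\mu$ is continuous and decreasing. It is convex decreasing if moreover $M_k^\mu$ is convex in $\mu$. An increasing family of test supermartingales for $\{H_0:\mathbf{E}(T)\ge\mu\}_\mu$ is a family obtained by taking a decreasing family for the variable $1-T$ (with sample $1-T_1,1-T_2,\ldots$) and replacing its parameter $\mu$ by $1-\mu$; thus for each $\mu<1$ it gives a test supermartingale for $H_0:\mathbf{E}(T)\ge\mu$ which, for every $k$, is increasing in $\mu$. It is convex increasing if moreover, for all $k$ and all realizations of the sample, it is convex in $\mu$. A random set $R$ of values $\mu$ is a $(1-\alpha)$-confidence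 interval for $\mathbf{E}(T)$ if it is an interval (possibly empty) and $\mathbb{P}\{\mathbf{E}(T)\in R\}\ge1-\alpha$.
   Formalization: Item 3 assumes both families have expectation at most 1 at time 0 under their nulls (false otherwise: constant family 100); at μ=0,1, where M_k^μ is undefined, it is extended by one-sided limits; realizations are those with all T_i in [0,1]. *)

theory Defs
  imports "HOL-Probability.Probability"
begin

text \<open>
  The probability law is unknown: S is the underlying measurable space, and the set PP consists of
  the probability measures on it that are considered possible.  A hypothesis is a subset of PP
  (the laws under which it is satisfied).  A single fixed law P is the case PP = {P}.  The variable
  X i with \<open>i \<ge> 1\<close> is the i-th sample variable; the value X 0 is never used.
\<close>

definition iid_sample :: "'w measure \<Rightarrow> ('w \<Rightarrow> real) \<Rightarrow> (nat \<Rightarrow> 'w \<Rightarrow> real) \<Rightarrow> bool" where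
  "iid_sample P T X \<longleftrightarrow>
     prob_space.indep_vars P (\<lambda>_. borel) X {1..} \<and>
     (\<forall>i\<ge>1. distr P borel (X i) = distr P borel T)"

definition sampling_model ::
  "'w measure \<Rightarrow> 'w measure set \<Rightarrow> ('w \<Rightarrow> real) \<Rightarrow> (nat \<Rightarrow> 'w \<Rightarrow> real) \<Rightarrow> bool" where
  "sampling_model S PP T X \<longleftrightarrow>
     T \<in> borel_measurable S \<and>
     (\<forall>i\<ge>1. X i \<in> borel_measurable S) \<and>
     (\<forall>P\<in>PP. prob_space P \<and> sets P = sets S \<and>
        (AE \<omega> in P. 0 \<le> T \<omega> \<and> T \<omega> \<le> 1) \<and> iid_sample P T X)"

text \<open>
  As T takes values in [0,1] only almost surely, the realizations of the sample are the outcomes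
  for which all sample values do lie in [0,1].  They form an event of probability 1 under each
  law in PP.  Without this restriction the integrated families below would fail to be monotone
  in the parameter on exceptional outcomes.
\<close>

definition realizations :: "'w measure \<Rightarrow> (nat \<Rightarrow> 'w \<Rightarrow> real) \<Rightarrow> 'w set" where
  "realizations S X = {\<omega> \<in> space S. \<forall>i\<ge>1. 0 \<le> X i \<omega> \<and> X i \<omega> \<le> 1}"

definition filtration_on :: "'w measure \<Rightarrow> (nat \<Rightarrow> 'w measure) \<Rightarrow> bool" where
  "filtration_on S F \<longleftrightarrow> filtration (space S) F \<and> (\<forall>k. subalgebra S (F k))"

definition supermartingale ::
  "'w measure \<Rightarrow> (nat \<Rightarrow> 'w measure) \<Rightarrow> (nat \<Rightarrow> 'w \<Rightarrow> real) \<Rightarrow> bool" where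
  "supermartingale P F Y \<longleftrightarrow>
     (\<forall>k. Y k \<in> borel_measurable (F k)) \<and>
     (\<forall>k. integrable P (Y k)) \<and>
     (\<forall>k. AE \<omega> in P. real_cond_exp P (F k) (Y (Suc k)) \<omega> \<le> Y k \<omega>)"

definition test_supermartingale ::
  "'w measure set \<Rightarrow> (nat \<Rightarrow> 'w measure) \<Rightarrow> (nat \<Rightarrow> 'w \<Rightarrow> real) \<Rightarrow> bool" where
  "test_supermartingale H0 F Y \<longleftrightarrow>
     (\<forall>k. Y k \<in> borel_measurable (F k)) \<and>
     (\<forall>P\<in>H0. supermartingale P F Y \<and> (\<forall>k. AE \<omega> in P. 0 \<le> Y k \<omega>) \<and>
        0 < prob_space.expectation P (Y 0))"

text \<open>
  Families of processes are written \<open>M k \<mu> \<omega>\<close>.  Their values for parameters outside the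
  stated range are irrelevant.
\<close>

definition decreasing_family ::
  "'w measure \<Rightarrow> 'w measure set \<Rightarrow> (nat \<Rightarrow> 'w measure) \<Rightarrow> ('w \<Rightarrow> real) \<Rightarrow> (nat \<Rightarrow> 'w \<Rightarrow> real)
     \<Rightarrow> (nat \<Rightarrow> real \<Rightarrow> 'w \<Rightarrow> real) \<Rightarrow> bool" where
  "decreasing_family S PP F T X M \<longleftrightarrow>
     (\<forall>\<mu>>0. test_supermartingale {P \<in> PP. prob_space.expectation P T \<le> \<mu>} F (\<lambda>k. M k \<mu>)) \<and>
     (\<forall>k. \<forall>\<omega>\<in>realizations S X.
        continuous_on {0<..} (\<lambda>\<mu>. M k \<mu> \<omega>) \<and> antimono_on {0<..} (\<lambda>\<mu>. M k \<mu> \<omega>))"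

definition convex_decreasing_family ::
  "'w measure \<Rightarrow> 'w measure set \<Rightarrow> (nat \<Rightarrow> 'w measure) \<Rightarrow> ('w \<Rightarrow> real) \<Rightarrow> (nat \<Rightarrow> 'w \<Rightarrow> real)
     \<Rightarrow> (nat \<Rightarrow> real \<Rightarrow> 'w \<Rightarrow> real) \<Rightarrow> bool" where
  "convex_decreasing_family S PP F T X M \<longleftrightarrow>
     decreasing_family S PP F T X M \<and>
     (\<forall>k. \<forall>\<omega>\<in>realizations S X. convex_on {0<..} (\<lambda>\<mu>. M k \<mu> \<omega>))"

definition increasing_family ::
  "'w measure \<Rightarrow> 'w measure set \<Rightarrow> (nat \<Rightarrow> 'w measure) \<Rightarrow> ('w \<Rightarrow> real) \<Rightarrow> (nat \<Rightarrow> 'w \<Rightarrow> real)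
     \<Rightarrow> (nat \<Rightarrow> real \<Rightarrow> 'w \<Rightarrow> real) \<Rightarrow> bool" where
  "increasing_family S PP F T X M \<longleftrightarrow>
     (\<exists>N. decreasing_family S PP F (\<lambda>\<omega>. 1 - T \<omega>) (\<lambda>i \<omega>. 1 - X i \<omega>) N \<and>
          M = (\<lambda>k \<mu>. N k (1 - \<mu>)))"

definition convex_increasing_family ::
  "'w measure \<Rightarrow> 'w measure set \<Rightarrow> (nat \<Rightarrow> 'w measure) \<Rightarrow> ('w \<Rightarrow> real) \<Rightarrow> (nat \<Rightarrow> 'w \<Rightarrow> real)
     \<Rightarrow> (nat \<Rightarrow> real \<Rightarrow> 'w \<Rightarrow> real) \<Rightarrow> bool" where
  "convex_increasing_family S PP F T X M \<longleftrightarrow>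
     increasing_family S PP F T X M \<and>
     (\<forall>k. \<forall>\<omega>\<in>realizations S X. convex_on {..<1} (\<lambda>\<mu>. M k \<mu> \<omega>))"

definition mixed_family ::
  "real \<Rightarrow> real \<Rightarrow> (nat \<Rightarrow> real \<Rightarrow> 'w \<Rightarrow> real) \<Rightarrow> (nat \<Rightarrow> real \<Rightarrow> 'w \<Rightarrow> real)
     \<Rightarrow> nat \<Rightarrow> real \<Rightarrow> 'w \<Rightarrow> real" where
  "mixed_family p_dec p_inc M_dec M_inc k \<mu> \<omega> = p_dec * M_dec k \<mu> \<omega> + p_inc * M_inc k \<mu> \<omega>"

text \<open>
  The mixed family is given for \<open>0 < \<mu> < 1\<close> only, whereas the mean of T and the sample averages
  may also be 0 or 1.  At the two boundary values a realization is extended by its one-sided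
  limit, which may be \<open>\<infinity>\<close>.
\<close>

definition boundary_ext :: "(real \<Rightarrow> real) \<Rightarrow> real \<Rightarrow> ereal" where
  "boundary_ext f \<mu> =
     (if 0 < \<mu> \<and> \<mu> < 1 then ereal (f \<mu>)
      else Lim (at \<mu> within {0<..<1}) (\<lambda>\<nu>. ereal (f \<nu>)))"

definition confidence_region ::
  "(nat \<Rightarrow> real \<Rightarrow> 'w \<Rightarrow> real) \<Rightarrow> real \<Rightarrow> nat set \<Rightarrow> 'w \<Rightarrow> real set" where
  "confidence_region M \<alpha> K \<omega> =
     {\<mu> \<in> {0..1}. \<forall>k\<in>K. boundary_ext (\<lambda>\<nu>. M k \<nu> \<omega>) \<mu> < ereal (1 / \<alpha>)}"

text \<open>
  A set that is not an event has \<open>measure\<close> 0, so for \<open>\<gamma> > 0\<close> the inequality below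
  includes the measurability of the coverage event.
\<close>

definition confidence_interval ::
  "'w measure \<Rightarrow> 'w measure set \<Rightarrow> ('w \<Rightarrow> real) \<Rightarrow> (nat \<Rightarrow> 'w \<Rightarrow> real) \<Rightarrow> real
     \<Rightarrow> ('w \<Rightarrow> real set) \<Rightarrow> bool" where
  "confidence_interval S PP T X \<gamma> R \<longleftrightarrow>
     (\<forall>\<omega>\<in>realizations S X. is_interval (R \<omega>)) \<and>
     (\<forall>P\<in>PP. \<gamma> \<le> measure P {\<omega> \<in> realizations S X. prob_space.expectation P T \<in> R \<omega>})"

definition prob_density_01 :: "(real \<Rightarrow> real) \<Rightarrow> bool" where
  "prob_density_01 \<pi> \<longleftrightarrow>
     (\<forall>c\<in>{0..1}. 0 \<le> \<pi> c) \<and> set_integrable lborel {0..1} \<pi> \<and> (LINT c:{0..1}|lborel. \<pi> c) = 1"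

definition integrated_dec ::
  "(real \<Rightarrow> real) \<Rightarrow> (nat \<Rightarrow> 'w \<Rightarrow> real) \<Rightarrow> nat \<Rightarrow> real \<Rightarrow> 'w \<Rightarrow> real" where
  "integrated_dec \<pi> X k \<mu> \<omega> =
     (LINT c:{0..1}|lborel. (\<Prod>i=1..k. (1 - c) + c * (X i \<omega> / \<mu>)) * \<pi> c)"

definition integrated_inc ::
  "(real \<Rightarrow> real) \<Rightarrow> (nat \<Rightarrow> 'w \<Rightarrow> real) \<Rightarrow> nat \<Rightarrow> real \<Rightarrow> 'w \<Rightarrow> real" where
  "integrated_inc \<pi> X k \<mu> \<omega> =
     (LINT c:{0..1}|lborel. (\<Prod>i=1..k. (1 - c) + c * ((1 - X i \<omega>) / (1 - \<mu>))) * \<pi> c)"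

end

theory Submission
  imports Defs
begin

text \<open>
  If the mean is \<open>\<mu>\<close>, then both \<open>E(T) \<le> \<mu>\<close> and \<open>E(T) \<ge> \<mu>\<close> hold, so the mixture is a nonnegative
  supermartingale and Ville's maximal inequality bounds the probability that it ever reaches
  \<open>1 / \<alpha>\<close>.  At the boundary means 0 and 1 one of the two parameters has to be shifted into the
  inner range; by monotonicity the extended process is then the increasing limit of
  supermartingales.  Sublevel sets of a convex function are intervals, and the existence of the
  boundary limits carries this over to [0,1].

  At the sample average the factors \<open>y i\<close> of the integrands sum to their number \<open>k\<close>, so their
  product is at most \<open>exp (\<Sum>i. y i - 1) = 1\<close>, and hence both integrated processes are at most 1.
\<close>

section \<open>Ville's maximal inequality and the coverage bound\<close>

text \<open>A finite-horizon bound is proved by induction on the horizon, and the events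
  \<open>A n\<close> of having reached \<open>c\<close> by time \<open>n\<close> then increase to
  the event in question.\<close>

lemma supermartingale_maximal_inequality:
  assumes "prob_space P" "filtration_on P F" "supermartingale P F Y"
    and nonneg: "\<And>k. AE \<omega> in P. 0 \<le> Y k \<omega>" and c: "0 < c"
  shows "measure P {\<omega> \<in> space P. \<exists>k. c \<le> Y k \<omega>} \<le> prob_space.expectation P (Y 0) / c"
proof -
  interpret prob_space P by fact
  have filt: "filtration (space P) F" and sub: "\<And>k. subalgebra P (F k)"
    using assms(2) by (auto simp: filtration_on_def)
  have adapted: "\<And>k. Y k \<in> borel_measurable (F k)" and int: "\<And>k. integrable P (Y k)"
    and step: "\<And>k. AE \<omega> in P. real_cond_exp P (F k) (Y (Suc k)) \<omega> \<le> Y k \<omega>"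
    using assms(3) by (auto simp: supermartingale_def)
  have [measurable]: "Y k \<in> borel_measurable P" for k
    using int by blast
  define A where "A n = {\<omega> \<in> space P. \<exists>k\<le>n. c \<le> Y k \<omega>}" for n
  have A_F: "A n \<in> sets (F n)" for n
  proof -
    have "Y k \<in> borel_measurable (F n)" if "k \<le> n" for k
      using adapted[of k] filtration.sets_F_mono[OF filt that] filtration.space_F[OF filt]
      by (metis measurable_mono subsetD order_refl)
    then have "(\<Union>k\<in>{..n}. {\<omega> \<in> space (F n). c \<le> Y k \<omega>}) \<in> sets (F n)"
      by (intro sets.finite_UN) auto
    also have "(\<Union>k\<in>{..n}. {\<omega> \<in> space (F n). c \<le> Y k \<omega>}) = A n"
      by (auto simp: A_def filtration.space_F[OF filt])
    finally show ?thesis .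
  qed
  have A_P[measurable, simp]: "A n \<in> sets P" for n
    using A_F sub by (auto simp: subalgebra_def)
  let ?B = "\<lambda>n. space P - A n"
  have intB: "integrable P (\<lambda>\<omega>. indicator (?B m) \<omega> * Y j \<omega>)" for m j
    by (subst mult.commute, rule integrable_real_mult_indicator) (auto intro: int)
  have [simp]: "integrable P (indicat_real B)" if "B \<in> sets P" for B
    using that by (intro integrable_real_indicator) (auto simp: less_top[symmetric])
  \<comment> \<open>The left side bounds from below the mean of the process stopped on first
    reaching \<open>c\<close>: crossed paths count with \<open>c\<close>, the others with their
    current value. Keeping the second term is what lets the induction pass.\<close>
  have bound: "c * prob (A n) + (LINT \<omega>:?B n|P. Y n \<omega>) \<le> expectation (Y 0)" for n
  proof (induction n)
    case 0
    have "c * prob (A 0) + (LINT \<omega>:?B 0|P. Y 0 \<omega>)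
        = (LINT \<omega>|P. c * indicator (A 0) \<omega> + indicator (?B 0) \<omega> * Y 0 \<omega>)"
      unfolding set_lebesgue_integral_def real_scaleR_def
      by (subst Bochner_Integration.integral_add) (use intB in auto)
    also have "\<dots> \<le> expectation (Y 0)"
      by (intro integral_mono int intB Bochner_Integration.integrable_add)
        (auto split: split_indicator, auto simp: A_def)
    finally show ?case .
  next
    case (Suc n)
    interpret sigma_finite_subalgebra P "F n"
      by (intro finite_measure_subalgebra_is_sigma_finite finite_measure_subalgebra.intro)
        (unfold_locales, simp add: finite_measure_subalgebra_axioms_def sub)
    have B_F: "?B n \<in> sets (F n)"
      using A_F[of n] by (metis sets.compl_sets filtration.space_F[OF filt])
    have "A n \<subseteq> A (Suc n)"
      by (auto simp: A_def le_Suc_eq)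
    then have "prob (A (Suc n)) = prob (A n) + prob (A (Suc n) - A n)"
      by (simp add: finite_measure_Diff)
    then have "c * prob (A (Suc n)) + (LINT \<omega>:?B (Suc n)|P. Y (Suc n) \<omega>)
        = c * prob (A n) +
          (LINT \<omega>|P. c * indicator (A (Suc n) - A n) \<omega> + indicator (?B (Suc n)) \<omega> * Y (Suc n) \<omega>)"
      unfolding set_lebesgue_integral_def real_scaleR_def
      by (subst Bochner_Integration.integral_add) (use intB in \<open>auto simp: algebra_simps\<close>)
    \<comment> \<open>On paths that first reach \<open>c\<close> at time \<open>Suc n\<close>, the
      level \<open>c\<close> is at most \<open>Y (Suc n)\<close>. Both terms thus merge into one
      integral over \<open>?B n\<close>, which is an event of \<open>F n\<close>, so the conditional
      expectation can enter.\<close>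
    also have "(LINT \<omega>|P. c * indicator (A (Suc n) - A n) \<omega> + indicator (?B (Suc n)) \<omega> * Y (Suc n) \<omega>)
        \<le> (LINT \<omega>|P. indicator (?B n) \<omega> * Y (Suc n) \<omega>)"
      by (intro integral_mono intB Bochner_Integration.integrable_add)
        (auto split: split_indicator simp: A_def le_Suc_eq)
    also have "\<dots> = (LINT \<omega>:?B n|P. real_cond_exp P (F n) (Y (Suc n)) \<omega>)"
      using real_cond_exp_intA[OF int B_F] by (simp add: set_lebesgue_integral_def)
    also have "\<dots> \<le> (LINT \<omega>:?B n|P. Y n \<omega>)"
      unfolding set_lebesgue_integral_def real_scaleR_def
    proof (rule integral_mono_AE)
      show "integrable P (\<lambda>\<omega>. indicator (?B n) \<omega> * real_cond_exp P (F n) (Y (Suc n)) \<omega>)"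
        by (subst mult.commute, rule integrable_real_mult_indicator)
          (auto intro: real_cond_exp_int int)
      show "AE \<omega> in P. indicator (?B n) \<omega> * real_cond_exp P (F n) (Y (Suc n)) \<omega>
          \<le> indicator (?B n) \<omega> * Y n \<omega>"
        using step[of n] by eventually_elim (auto split: split_indicator)
    qed (rule intB)
    finally show ?case
      using Suc.IH by simp
  qed
  have "prob (A n) \<le> expectation (Y 0) / c" for n
  proof -
    have "0 \<le> (LINT \<omega>:?B n|P. Y n \<omega>)"
      unfolding set_lebesgue_integral_def real_scaleR_def
      by (rule integral_nonneg_AE) (use nonneg[of n] in \<open>eventually_elim, auto split: split_indicator\<close>)
    then show ?thesis
      using bound[of n] c by (simp add: field_simps)
  qed
  moreover have "(\<lambda>n. prob (A n)) \<longlonglongrightarrow> prob (\<Union>n. A n)"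
    by (rule finite_Lim_measure_incseq) (auto simp: incseq_def A_def intro: order_trans)
  moreover have "(\<Union>n. A n) = {\<omega> \<in> space P. \<exists>k. c \<le> Y k \<omega>}"
    by (auto simp: A_def)
  ultimately show ?thesis
    by (metis LIMSEQ_le_const2)
qed

text \<open>
  Covers the boundary means: there the extended process is only an increasing limit of
  supermartingales, and Ville's inequality is applied to the approximations at levels below
  \<open>1 / \<alpha>\<close>, since a supremum may reach the level \<open>1 / \<alpha>\<close> without any approximation doing so.
\<close>

lemma coverage_SUP_supermartingales:
  fixes Y :: "nat \<Rightarrow> nat \<Rightarrow> 'w \<Rightarrow> real"
  assumes "prob_space P" "filtration_on P F" "\<And>n. supermartingale P F (Y n)"
    and nonneg: "\<And>n k. AE \<omega> in P. 0 \<le> Y n k \<omega>"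
    and init: "\<And>n. prob_space.expectation P (Y n 0) \<le> 1"
    and E[measurable]: "E \<in> sets P" and AE_E: "AE \<omega> in P. \<omega> \<in> E"
    and mono: "\<And>k \<omega>. \<omega> \<in> E \<Longrightarrow> incseq (\<lambda>n. Y n k \<omega>)"
    and \<alpha>: "0 < \<alpha>"
  shows "1 - \<alpha> \<le> measure P {\<omega> \<in> E. \<forall>k\<in>K. (SUP n. ereal (Y n k \<omega>)) < ereal (1 / \<alpha>)}"
proof -
  interpret prob_space P by fact
  have [measurable]: "Y n k \<in> borel_measurable P" for n k
    using assms(3)[of n] by (auto simp: supermartingale_def)
  have E_space: "E \<subseteq> space P"
    using E by (rule sets.sets_into_space)
  define U where "U = {\<omega> \<in> E. \<exists>k. ereal (1 / \<alpha>) \<le> (SUP n. ereal (Y n k \<omega>))}"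
  define G where "G = {\<omega> \<in> E. \<forall>k\<in>K. (SUP n. ereal (Y n k \<omega>)) < ereal (1 / \<alpha>)}"
  have "U = E \<inter> {\<omega> \<in> space P. \<exists>k. ereal (1 / \<alpha>) \<le> (SUP n. ereal (Y n k \<omega>))}"
    using E_space by (auto simp: U_def)
  also have "\<dots> \<in> sets P" by measurable
  finally have [measurable]: "U \<in> sets P" .
  have "G = E \<inter> {\<omega> \<in> space P. \<forall>k\<in>K. (SUP n. ereal (Y n k \<omega>)) < ereal (1 / \<alpha>)}"
    using E_space by (auto simp: G_def)
  also have "\<dots> \<in> sets P" by measurable
  finally have [measurable]: "G \<in> sets P" .
  have "prob U \<le> \<beta>" if \<beta>: "\<alpha> < \<beta>" for \<beta>
  proof -
    define C where "C n = {\<omega> \<in> E. \<exists>k. 1 / \<beta> \<le> Y n k \<omega>}" for n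
    have "C n = E \<inter> {\<omega> \<in> space P. \<exists>k. 1 / \<beta> \<le> Y n k \<omega>}" for n
      using E_space by (auto simp: C_def)
    then have [measurable]: "C n \<in> sets P" for n by simp
    have "prob (C n) \<le> \<beta>" for n
    proof -
      have "prob (C n) \<le> prob {\<omega> \<in> space P. \<exists>k. 1 / \<beta> \<le> Y n k \<omega>}"
        using E_space by (intro finite_measure_mono) (auto simp: C_def)
      also have "\<dots> \<le> expectation (Y n 0) / (1 / \<beta>)"
        using \<alpha> \<beta> by (intro supermartingale_maximal_inequality[OF assms(1-3) nonneg]) auto
      also have "\<dots> \<le> 1 / (1 / \<beta>)"
        using \<alpha> \<beta> init[of n] by (intro divide_right_mono) auto
      finally show ?thesis by simp
    qed
    moreover have "(\<lambda>n. prob (C n)) \<longlonglongrightarrow> prob (\<Union>n. C n)"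
    proof (rule finite_Lim_measure_incseq)
      show "incseq C"
        using mono by (fastforce simp: incseq_def C_def intro: order_trans)
    qed auto
    ultimately have "prob (\<Union>n. C n) \<le> \<beta>"
      by (meson LIMSEQ_le_const2)
    moreover have "U \<subseteq> (\<Union>n. C n)"
    proof
      fix \<omega> assume "\<omega> \<in> U"
      then obtain k where k: "\<omega> \<in> E" "ereal (1 / \<alpha>) \<le> (SUP n. ereal (Y n k \<omega>))"
        by (auto simp: U_def)
      have "ereal (1 / \<beta>) < ereal (1 / \<alpha>)"
        using \<alpha> \<beta> by (simp add: field_simps)
      then have "ereal (1 / \<beta>) < (SUP n. ereal (Y n k \<omega>))"
        using k(2) by (rule order_less_le_trans)
      then obtain n where "1 / \<beta> < Y n k \<omega>"
        by (auto simp: less_SUP_iff)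
      then show "\<omega> \<in> (\<Union>n. C n)"
        using k(1) less_imp_le by (fastforce simp: C_def)
    qed
    ultimately show ?thesis
      by (meson finite_measure_mono order_trans sets.countable_UN' countableI_type
          \<open>\<And>n. C n \<in> sets P\<close> sets.countable_nat_UN image_subsetI)
  qed
  then have "prob U \<le> \<alpha>"
    by (rule dense_ge)
  moreover have "prob (E - U) = prob E - prob U"
    by (rule finite_measure_Diff) (auto simp: U_def)
  moreover have "prob E = 1"
    using AE_E by (simp add: prob_eq_1)
  \<comment> \<open>\<open>U\<close> looks at all times and \<open>G\<close> only at those in
    \<open>K\<close>, so a single maximal inequality serves every set of times.\<close>
  moreover have "prob (E - U) \<le> prob G"
    by (rule finite_measure_mono) (auto simp: U_def G_def not_le)
  ultimately show ?thesis
    by (simp add: G_def)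
qed

section \<open>The sample values and the mean lie in the unit interval\<close>

text \<open>The almost sure bound on \<open>T\<close> passes to each \<open>X i\<close> because
  their laws agree, and only countably many null sets are involved.\<close>

lemma AE_realizations:
  assumes "sampling_model S PP T X" "P \<in> PP"
  shows "AE \<omega> in P. \<omega> \<in> realizations S X"
proof -
  have T: "T \<in> borel_measurable P" and X: "\<And>i. i \<ge> 1 \<Longrightarrow> X i \<in> borel_measurable P"
    and sets: "sets P = sets S"
    using assms by (auto simp: sampling_model_def cong: measurable_cong_sets)
  have "AE \<omega> in P. \<omega> \<in> space P \<and> (i \<ge> 1 \<longrightarrow> 0 \<le> X i \<omega> \<and> X i \<omega> \<le> 1)" for i
  proof (cases "i \<ge> 1")
    case True
    have "AE x in distr P borel T. 0 \<le> x \<and> x \<le> 1"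
      using assms by (subst AE_distr_iff[OF T]) (auto simp: sampling_model_def)
    also have "distr P borel T = distr P borel (X i)"
      using assms True by (simp add: sampling_model_def iid_sample_def)
    finally show ?thesis
      using True by (subst (asm) AE_distr_iff[OF X]) auto
  qed auto
  then have "AE \<omega> in P. \<forall>i. \<omega> \<in> space P \<and> (i \<ge> 1 \<longrightarrow> 0 \<le> X i \<omega> \<and> X i \<omega> \<le> 1)"
    by (simp only: AE_all_countable) blast
  then show ?thesis
    by eventually_elim (simp add: realizations_def sets_eq_imp_space_eq[OF sets])
qed

lemma realizations_in_sets:
  assumes "sampling_model S PP T X"
  shows "realizations S X \<in> sets S"
proof -
  have "{\<omega> \<in> space S. 0 \<le> X i \<omega> \<and> X i \<omega> \<le> 1} \<in> sets S" if "i \<ge> 1" for i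
  proof -
    have [measurable]: "X i \<in> borel_measurable S"
      using assms that by (simp add: sampling_model_def)
    show ?thesis by measurable
  qed
  then have "(\<Inter>i\<in>{1..}. {\<omega> \<in> space S. 0 \<le> X i \<omega> \<and> X i \<omega> \<le> 1}) \<in> sets S"
    by (intro sets.countable_INT) auto
  also have "(\<Inter>i\<in>{1..}. {\<omega> \<in> space S. 0 \<le> X i \<omega> \<and> X i \<omega> \<le> 1}) = realizations S X"
    by (auto simp: realizations_def)
  finally show ?thesis .
qed

lemma mean_in_unit_interval:
  assumes "sampling_model S PP T X" "P \<in> PP"
  shows "integrable P T" "prob_space.expectation P T \<in> {0..1}"
proof -
  interpret prob_space P
    using assms by (simp add: sampling_model_def)
  have T[measurable]: "T \<in> borel_measurable P" and AE: "AE \<omega> in P. 0 \<le> T \<omega> \<and> T \<omega> \<le> 1"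
    using assms by (auto simp: sampling_model_def cong: measurable_cong_sets)
  show "integrable P T"
    by (rule integrable_const_bound[of _ 1]) (use AE in auto)
  then show "expectation T \<in> {0..1}"
    using AE integral_mono_AE[of P "\<lambda>_. 0" T] integral_mono_AE[of P T "\<lambda>_. 1"]
    by (auto simp: prob_space)
qed

section \<open>Mixtures of supermartingales and reflected families\<close>

lemma supermartingale_lincomb:
  assumes "prob_space P" "filtration_on P F" "supermartingale P F Y" "supermartingale P F Z"
    and "0 \<le> p" "0 \<le> q"
  shows "supermartingale P F (\<lambda>k \<omega>. p * Y k \<omega> + q * Z k \<omega>)"
  unfolding supermartingale_def
proof (intro conjI allI)
  interpret prob_space P by fact
  have int: "integrable P (Y k)" "integrable P (Z k)" for k
    using assms by (auto simp: supermartingale_def)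
  fix k
  have [measurable]: "Y k \<in> borel_measurable (F k)" "Z k \<in> borel_measurable (F k)"
    using assms by (auto simp: supermartingale_def)
  show "(\<lambda>\<omega>. p * Y k \<omega> + q * Z k \<omega>) \<in> borel_measurable (F k)"
    by measurable
  show "integrable P (\<lambda>\<omega>. p * Y k \<omega> + q * Z k \<omega>)"
    using int by auto
  interpret sigma_finite_subalgebra P "F k"
    using assms(2)
    by (intro finite_measure_subalgebra_is_sigma_finite finite_measure_subalgebra.intro)
      (unfold_locales, simp add: finite_measure_subalgebra_axioms_def filtration_on_def)
  have "AE \<omega> in P. real_cond_exp P (F k) (Y (Suc k)) \<omega> \<le> Y k \<omega>"
    "AE \<omega> in P. real_cond_exp P (F k) (Z (Suc k)) \<omega> \<le> Z k \<omega>"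
    using assms by (auto simp: supermartingale_def)
  moreover have "AE \<omega> in P. real_cond_exp P (F k) (\<lambda>\<omega>. p * Y (Suc k) \<omega> + q * Z (Suc k) \<omega>) \<omega>
      = real_cond_exp P (F k) (\<lambda>\<omega>. p * Y (Suc k) \<omega>) \<omega>
        + real_cond_exp P (F k) (\<lambda>\<omega>. q * Z (Suc k) \<omega>) \<omega>"
    using int by (intro real_cond_exp_add) auto
  moreover note real_cond_exp_cmult[OF int(1)[of "Suc k"], of p]
    real_cond_exp_cmult[OF int(2)[of "Suc k"], of q]
  ultimately show "AE \<omega> in P. real_cond_exp P (F k) (\<lambda>\<omega>. p * Y (Suc k) \<omega> + q * Z (Suc k) \<omega>) \<omega>
      \<le> p * Y k \<omega> + q * Z k \<omega>"
    by eventually_elim (use assms in \<open>auto intro!: add_mono mult_left_mono\<close>)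
qed

text \<open>Everything is transported along the reflection of values and parameters at 1/2. It
  reverses the order in the hypothesis, since the mean of \<open>1 - T\<close> is 1 minus that of
  \<open>T\<close>, and it leaves the set of realizations unchanged.\<close>

lemma increasing_familyD:
  assumes "sampling_model S PP T X" "increasing_family S PP F T X M"
  shows "\<And>\<mu>. \<mu> < 1 \<Longrightarrow>
      test_supermartingale {P \<in> PP. \<mu> \<le> prob_space.expectation P T} F (\<lambda>k. M k \<mu>)"
    and "\<And>k \<omega>. \<omega> \<in> realizations S X \<Longrightarrow> continuous_on {..<1} (\<lambda>\<mu>. M k \<mu> \<omega>)"
    and "\<And>k \<omega>. \<omega> \<in> realizations S X \<Longrightarrow> mono_on {..<1} (\<lambda>\<mu>. M k \<mu> \<omega>)"
proof -
  obtain N where N: "decreasing_family S PP F (\<lambda>\<omega>. 1 - T \<omega>) (\<lambda>i \<omega>. 1 - X i \<omega>) N"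
    and M: "M = (\<lambda>k \<mu>. N k (1 - \<mu>))"
    using assms(2) by (auto simp: increasing_family_def)
  have "prob_space.expectation P (\<lambda>\<omega>. 1 - T \<omega>) = 1 - prob_space.expectation P T" if "P \<in> PP" for P
  proof -
    interpret prob_space P
      using assms(1) that by (simp add: sampling_model_def)
    show ?thesis
      using mean_in_unit_interval(1)[OF assms(1) that] by (simp add: prob_space)
  qed
  then have "{P \<in> PP. prob_space.expectation P (\<lambda>\<omega>. 1 - T \<omega>) \<le> 1 - \<mu>}
      = {P \<in> PP. \<mu> \<le> prob_space.expectation P T}" for \<mu>
    by auto
  then show "test_supermartingale {P \<in> PP. \<mu> \<le> prob_space.expectation P T} F (\<lambda>k. M k \<mu>)"
    if "\<mu> < 1" for \<mu>
    using N that by (auto simp: decreasing_family_def M dest!: spec[of _ "1 - \<mu>"])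
  have "realizations S (\<lambda>i \<omega>. 1 - X i \<omega>) = realizations S X"
    by (auto simp: realizations_def)
  then have *: "continuous_on {0<..} (\<lambda>\<mu>. N k \<mu> \<omega>)" "antimono_on {0<..} (\<lambda>\<mu>. N k \<mu> \<omega>)"
    if "\<omega> \<in> realizations S X" for k \<omega>
    using N that by (auto simp: decreasing_family_def)
  fix k \<omega> assume \<omega>: "\<omega> \<in> realizations S X"
  show "continuous_on {..<1} (\<lambda>\<mu>. M k \<mu> \<omega>)"
    unfolding M by (rule continuous_on_compose2[OF *(1)[OF \<omega>]]) (auto intro!: continuous_intros)
  show "mono_on {..<1} (\<lambda>\<mu>. M k \<mu> \<omega>)"
    using *(2)[OF \<omega>, of k] by (auto simp: M monotone_on_def)
qed

lemma test_supermartingale_lincomb: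
  assumes model: "sampling_model S PP T X" "filtration_on S F" and H: "H \<subseteq> PP"
    and Y: "test_supermartingale H F Y" and Z: "test_supermartingale H F Z"
    and pq: "0 \<le> p" "0 \<le> q" "p + q = 1"
  shows "test_supermartingale H F (\<lambda>k \<omega>. p * Y k \<omega> + q * Z k \<omega>)"
  unfolding test_supermartingale_def
proof (intro conjI allI ballI)
  fix k
  have [measurable]: "Y k \<in> borel_measurable (F k)" "Z k \<in> borel_measurable (F k)"
    using Y Z by (auto simp: test_supermartingale_def)
  show "(\<lambda>\<omega>. p * Y k \<omega> + q * Z k \<omega>) \<in> borel_measurable (F k)"
    by measurable
next
  fix P assume P: "P \<in> H"
  then have "prob_space P" "sets P = sets S"
    using model H by (auto simp: sampling_model_def)
  then have "filtration_on P F"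
    using model(2) sets_eq_imp_space_eq[of P S] by (auto simp: filtration_on_def subalgebra_def)
  have YZ: "supermartingale P F Y" "supermartingale P F Z"
    "\<And>k. AE \<omega> in P. 0 \<le> Y k \<omega>" "\<And>k. AE \<omega> in P. 0 \<le> Z k \<omega>"
    "0 < prob_space.expectation P (Y 0)" "0 < prob_space.expectation P (Z 0)"
    using Y Z P by (auto simp: test_supermartingale_def)
  show "supermartingale P F (\<lambda>k \<omega>. p * Y k \<omega> + q * Z k \<omega>)"
    by (rule supermartingale_lincomb) fact+
  show "AE \<omega> in P. 0 \<le> p * Y k \<omega> + q * Z k \<omega>" for k
    using YZ(3)[of k] YZ(4)[of k] by eventually_elim (use pq in auto)
  \<comment> \<open>One weight may vanish, but not both, as they sum to 1; hence the case
    split.\<close>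
  have "0 < p * prob_space.expectation P (Y 0) + q * prob_space.expectation P (Z 0)"
    using YZ(5,6) pq by (cases "p = 0") (auto intro: add_pos_nonneg)
  then show "0 < prob_space.expectation P (\<lambda>\<omega>. p * Y 0 \<omega> + q * Z 0 \<omega>)"
    using YZ(1,2) by (simp add: supermartingale_def)
qed

lemma test_supermartingale_subset:
  "test_supermartingale H F Y \<Longrightarrow> G \<subseteq> H \<Longrightarrow> test_supermartingale G F Y"
  by (auto simp: test_supermartingale_def)

section \<open>Limits at the boundary of the parameter range\<close>

text \<open>Makes limits at the two endpoints unique, so that \<open>Lim\<close> in
  \<open>boundary_ext\<close> is whatever limit is exhibited. It also yields inner points near an
  endpoint from eventual statements.\<close>

lemma at_within_unit_interval_neq_bot:
  "\<mu> = 0 \<or> \<mu> = 1 \<Longrightarrow> at \<mu> within {0<..<1::real} \<noteq> bot"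
  using islimpt_greaterThanLessThan1[of 0 "1::real"] islimpt_greaterThanLessThan2[of 0 "1::real"]
  by (auto simp: trivial_limit_within)

lemma boundary_ext_eqI:
  assumes "\<mu> = 0 \<or> \<mu> = 1" "((\<lambda>\<nu>. ereal (f \<nu>)) \<longlongrightarrow> L) (at \<mu> within {0<..<1})"
  shows "boundary_ext f \<mu> = L"
proof -
  show ?thesis
    using assms at_within_unit_interval_neq_bot[OF assms(1)]
    by (auto simp: boundary_ext_def intro!: tendsto_Lim)
qed

text \<open>The first assumption pushes \<open>h\<close> above anything below the supremum, the
  second keeps it below the supremum. The index in the second may depend on the point, so the
  supremum may be infinite.\<close>

lemma tendsto_ereal_SUP:
  fixes h :: "'a \<Rightarrow> real" and a :: "nat \<Rightarrow> real"
  assumes "\<And>n. eventually (\<lambda>x. a n \<le> h x) F" "eventually (\<lambda>x. \<exists>n. h x \<le> a n) F"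
  shows "((\<lambda>x. ereal (h x)) \<longlongrightarrow> (SUP n. ereal (a n))) F"
proof (rule order_tendstoI)
  fix l assume "l < (SUP n. ereal (a n))"
  then obtain n where n: "l < ereal (a n)"
    by (auto simp: less_SUP_iff)
  show "eventually (\<lambda>x. l < ereal (h x)) F"
    using assms(1)[of n] by eventually_elim (use n in \<open>auto intro: order_less_le_trans\<close>)
next
  fix u assume u: "(SUP n. ereal (a n)) < u"
  show "eventually (\<lambda>x. ereal (h x) < u) F"
    using assms(2)
  proof eventually_elim
    case (elim x)
    then obtain n where "ereal (h x) \<le> ereal (a n)" by auto
    also have "\<dots> \<le> (SUP n. ereal (a n))" by (rule SUP_upper) simp
    finally show ?case using u by (rule order_le_less_trans)
  qed
qed

text \<open>The number \<open>b\<close> is moved inside the supremum, and the remaining summand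
  \<open>g x - b\<close> tends to 0. Addition of extended reals is continuous here because the
  supremum is not \<open>-\<infinity>\<close>.\<close>

lemma tendsto_ereal_SUP_add:
  fixes h g :: "'a \<Rightarrow> real" and a :: "nat \<Rightarrow> real"
  assumes "\<And>n. eventually (\<lambda>x. a n \<le> h x) F" "eventually (\<lambda>x. \<exists>n. h x \<le> a n) F"
    and g: "(g \<longlongrightarrow> b) F"
  shows "((\<lambda>x. ereal (h x + g x)) \<longlongrightarrow> (SUP n. ereal (a n + b))) F"
proof -
  let ?L = "SUP n. ereal (a n + b)"
  have "((\<lambda>x. ereal (h x + b)) \<longlongrightarrow> ?L) F"
    using assms(1,2) by (intro tendsto_ereal_SUP) auto
  moreover have "((\<lambda>x. g x - b) \<longlongrightarrow> 0) F"
    using g by (simp add: LIM_zero)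
  then have "((\<lambda>x. ereal (g x - b)) \<longlongrightarrow> 0) F"
    by (simp add: zero_ereal_def)
  moreover have "ereal (a 0 + b) \<le> ?L"
    by (rule SUP_upper) simp
  then have "?L \<noteq> -\<infinity>" by auto
  ultimately have "((\<lambda>x. ereal (h x + b) + ereal (g x - b)) \<longlongrightarrow> ?L + 0) F"
    by (intro tendsto_add_ereal_nonneg) auto
  then show ?thesis by simp
qed

text \<open>
  For every \<open>\<mu>\<close> in [0,1] the two parameters below are at least, respectively at most, \<open>\<mu>\<close> and
  lie in the range of the respective family, so both processes are supermartingales when the
  mean is \<open>\<mu>\<close>.  For inner \<open>\<mu>\<close> both parameters are eventually equal to \<open>\<mu>\<close>.
\<close>

definition inner_approx :: "(real \<Rightarrow> real) \<Rightarrow> (real \<Rightarrow> real) \<Rightarrow> real \<Rightarrow> nat \<Rightarrow> real" where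
  "inner_approx f g \<mu> n = f (max \<mu> (1 / real (n + 2))) + g (min \<mu> (1 - 1 / real (n + 2)))"

text \<open>With growing \<open>n\<close> the parameter of \<open>f\<close> moves down and that of
  \<open>g\<close> moves up, and both moves raise the value.\<close>

lemma inner_approx_mono:
  assumes "antimono_on {0<..} f" "mono_on {..<1} g"
  shows "incseq (inner_approx f g \<mu>)"
proof (rule incseq_SucI)
  fix n
  have "1 / real (Suc n + 2) \<le> 1 / real (n + 2)"
    by (simp add: field_simps)
  moreover have "0 < 1 / real (Suc n + 2)" "0 < 1 / real (n + 2)"
    by auto
  ultimately show "inner_approx f g \<mu> n \<le> inner_approx f g \<mu> (Suc n)"
    unfolding inner_approx_def
    by (intro add_mono monotone_onD[OF assms(1)] monotone_onD[OF assms(2)])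
      (auto simp: less_max_iff_disj min_less_iff_disj)
qed

lemma inverse_nat_less_obtains:
  assumes "0 < (e::real)"
  obtains n where "1 / real (n + 2) < e"
proof -
  obtain n where "1 / e < real n" using reals_Archimedean2 by blast
  then have "1 / real (n + 2) < e"
    using assms by (simp add: field_simps)
  then show ?thesis by (rule that)
qed

text \<open>At 0 only \<open>f\<close> can be unbounded, while \<open>g\<close> is continuous there;
  at 1 the roles are exchanged. By monotonicity the values of the critical function along
  \<open>1 / real (n + 2)\<close>, or its reflection, decide the limit.\<close>

lemma tendsto_inner_approx:
  assumes \<mu>: "\<mu> = 0 \<or> \<mu> = 1"
    and f: "antimono_on {0<..} f" "continuous_on {0<..} f"
    and g: "mono_on {..<1} g" "continuous_on {..<1} g"
  shows "((\<lambda>\<nu>. ereal (f \<nu> + g \<nu>)) \<longlongrightarrow> (SUP n. ereal (inner_approx f g \<mu> n)))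
    (at \<mu> within {0<..<1})"
  using \<mu>
proof
  assume \<mu>: "\<mu> = 0"
  have eq: "inner_approx f g 0 n = f (1 / real (n + 2)) + g 0" for n
    by (simp add: inner_approx_def field_simps min_def max_def)
  have "eventually (\<lambda>\<nu>. f (1 / real (n + 2)) \<le> f \<nu>) (at 0 within {0<..<1})" for n
    unfolding eventually_at
    by (rule exI[of _ "1 / real (n + 2)"]) (auto simp: dist_real_def intro!: monotone_onD[OF f(1)])
  moreover have "eventually (\<lambda>\<nu>. \<exists>n. f \<nu> \<le> f (1 / real (n + 2))) (at 0 within {0<..<1})"
    unfolding eventually_at
  proof (rule exI[of _ 1], intro conjI ballI impI)
    fix \<nu> :: real assume \<nu>: "\<nu> \<in> {0<..<1}"
    then obtain n where "1 / real (n + 2) < \<nu>"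
      using inverse_nat_less_obtains by auto
    then have "f \<nu> \<le> f (1 / real (n + 2))"
      using \<nu> by (intro monotone_onD[OF f(1)]) auto
    then show "\<exists>n. f \<nu> \<le> f (1 / real (n + 2))" ..
  qed simp
  moreover have "(g \<longlongrightarrow> g 0) (at 0 within {0<..<1})"
    by (rule tendsto_within_subset[OF bspec[OF g(2)[unfolded continuous_on]]]) auto
  ultimately show ?thesis
    unfolding \<mu> eq by (rule tendsto_ereal_SUP_add)
next
  assume \<mu>: "\<mu> = 1"
  have eq: "inner_approx f g 1 n = g (1 - 1 / real (n + 2)) + f 1" for n
    by (simp add: inner_approx_def field_simps min_def max_def)
  have "eventually (\<lambda>\<nu>. g (1 - 1 / real (n + 2)) \<le> g \<nu>) (at 1 within {0<..<1})" for n
    unfolding eventually_at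
    by (rule exI[of _ "1 / real (n + 2)"]) (auto simp: dist_real_def intro!: monotone_onD[OF g(1)])
  moreover have "eventually (\<lambda>\<nu>. \<exists>n. g \<nu> \<le> g (1 - 1 / real (n + 2))) (at 1 within {0<..<1})"
    unfolding eventually_at
  proof (rule exI[of _ 1], intro conjI ballI impI)
    fix \<nu> :: real assume \<nu>: "\<nu> \<in> {0<..<1}"
    then obtain n where "1 / real (n + 2) < 1 - \<nu>"
      using inverse_nat_less_obtains[of "1 - \<nu>"] by auto
    then have "g \<nu> \<le> g (1 - 1 / real (n + 2))"
      using \<nu> by (intro monotone_onD[OF g(1)]) auto
    then show "\<exists>n. g \<nu> \<le> g (1 - 1 / real (n + 2))" ..
  qed simp
  moreover have "(f \<longlongrightarrow> f 1) (at 1 within {0<..<1})"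
    by (rule tendsto_within_subset[OF bspec[OF f(2)[unfolded continuous_on]]]) auto
  ultimately have "((\<lambda>\<nu>. ereal (g \<nu> + f \<nu>)) \<longlongrightarrow> (SUP n. ereal (g (1 - 1 / real (n + 2)) + f 1)))
      (at 1 within {0<..<1})"
    by (rule tendsto_ereal_SUP_add)
  then show ?thesis
    unfolding \<mu> eq by (simp only: add.commute)
qed

text \<open>Brings the extended value into the form that
  \<open>coverage_SUP_supermartingales\<close> works with, for inner and boundary parameters
  alike.\<close>

lemma boundary_ext_SUP_inner_approx:
  assumes \<mu>: "\<mu> \<in> {0..1}"
    and f: "antimono_on {0<..} f" "continuous_on {0<..} f"
    and g: "mono_on {..<1} g" "continuous_on {..<1} g"
  shows "boundary_ext (\<lambda>\<nu>. f \<nu> + g \<nu>) \<mu> = (SUP n. ereal (inner_approx f g \<mu> n))"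
proof (cases "0 < \<mu> \<and> \<mu> < 1")
  case True
  \<comment> \<open>For this \<open>n\<close> both the \<open>max\<close> and the \<open>min\<close>
    in \<open>inner_approx\<close> return \<mu>, so the supremum is attained.\<close>
  then obtain n where n: "1 / real (n + 2) < min \<mu> (1 - \<mu>)"
    using inverse_nat_less_obtains[of "min \<mu> (1 - \<mu>)"] by auto
  have "(SUP n. ereal (inner_approx f g \<mu> n)) = ereal (f \<mu> + g \<mu>)"
  proof (rule antisym)
    show "(SUP n. ereal (inner_approx f g \<mu> n)) \<le> ereal (f \<mu> + g \<mu>)"
      unfolding inner_approx_def using True
      by (auto intro!: SUP_least add_mono monotone_onD[OF f(1)] monotone_onD[OF g(1)]
          simp: less_max_iff_disj min_less_iff_disj)
    have "max \<mu> (1 / real (n + 2)) = \<mu>" "min \<mu> (1 - 1 / real (n + 2)) = \<mu>"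
      using n by (auto simp del: of_nat_add)
    then have "f \<mu> + g \<mu> = inner_approx f g \<mu> n"
      by (simp only: inner_approx_def)
    then show "ereal (f \<mu> + g \<mu>) \<le> (SUP n. ereal (inner_approx f g \<mu> n))"
      by (auto intro: SUP_upper)
  qed
  then show ?thesis
    using True by (simp add: boundary_ext_def)
next
  case False
  then have "\<mu> = 0 \<or> \<mu> = 1" using \<mu> by auto
  then show ?thesis
    using tendsto_inner_approx[OF _ f g] by (intro boundary_ext_eqI)
qed

section \<open>Regions cut out by convex functions are intervals\<close>

text \<open>Convexity is only available for inner parameters. An endpoint of the region that is 0 or
  1 is therefore replaced by a nearby inner point at which the function is still below the
  level.\<close>

lemma is_interval_boundary_ext_less:
  fixes c :: "'k \<Rightarrow> ereal"
  assumes conv: "\<And>k. k \<in> K \<Longrightarrow> convex_on {0<..<1} (f k)"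
    and lim: "\<And>k \<mu>. k \<in> K \<Longrightarrow> \<mu> = 0 \<or> \<mu> = 1 \<Longrightarrow>
      ((\<lambda>\<nu>. ereal (f k \<nu>)) \<longlongrightarrow> boundary_ext (f k) \<mu>) (at \<mu> within {0<..<1})"
  shows "is_interval {\<mu> \<in> {0..1}. \<forall>k\<in>K. boundary_ext (f k) \<mu> < c k}"
proof -
  have inner: "\<exists>\<nu>\<in>{0<..<1}. ereal (f k \<nu>) < c k \<and> \<bar>\<nu> - a\<bar> < e"
    if "a \<in> {0..1}" "boundary_ext (f k) a < c k" "k \<in> K" "0 < e" for a k and e :: real
  proof (cases "a = 0 \<or> a = 1")
    case True
    have "eventually (\<lambda>\<nu>. ereal (f k \<nu>) < c k) (at a within {0<..<1})"
      using lim[OF \<open>k \<in> K\<close> True] that(2) by (rule order_tendstoD)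
    moreover have "eventually (\<lambda>\<nu>. \<nu> \<in> {0<..<1} \<and> \<bar>\<nu> - a\<bar> < e) (at a within {0<..<1})"
      unfolding eventually_at using \<open>0 < e\<close> by (auto simp: dist_real_def)
    ultimately have "eventually (\<lambda>\<nu>. \<nu> \<in> {0<..<1} \<and> ereal (f k \<nu>) < c k \<and> \<bar>\<nu> - a\<bar> < e)
        (at a within {0<..<1})"
      by eventually_elim auto
    moreover have "at a within {0<..<1::real} \<noteq> bot"
      using True by (rule at_within_unit_interval_neq_bot)
    ultimately show ?thesis
      using eventually_happens' by blast
  next
    case False
    then show ?thesis
      using that by (intro bexI[of _ a]) (auto simp: boundary_ext_def)
  qed
  show ?thesis
    unfolding is_interval_1
  proof (intro ballI allI impI)
    fix a b x
    assume a: "a \<in> {\<mu> \<in> {0..1}. \<forall>k\<in>K. boundary_ext (f k) \<mu> < c k}"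
      and b: "b \<in> {\<mu> \<in> {0..1}. \<forall>k\<in>K. boundary_ext (f k) \<mu> < c k}"
      and x: "a \<le> x \<and> x \<le> b"
    show "x \<in> {\<mu> \<in> {0..1}. \<forall>k\<in>K. boundary_ext (f k) \<mu> < c k}"
    proof (cases "x = a \<or> x = b")
      case True
      then show ?thesis using a b by auto
    next
      case False
      then have x: "a < x" "x < b" "0 < x" "x < 1"
        using x a b by auto
      have "ereal (f k x) < c k" if k: "k \<in> K" for k
      proof -
        \<comment> \<open>The radii \<open>x - a\<close> and \<open>b - x\<close> keep
          \<open>x\<close> strictly between \<open>u\<close> and \<open>v\<close>. These points may
          depend on \<open>k\<close>, as each inequality is proved separately.\<close>
        obtain u where "u \<in> {0<..<1}" "ereal (f k u) < c k" "\<bar>u - a\<bar> < x - a"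
          using inner[of a k "x - a"] a k x by auto
        then have u: "0 < u" "u < x" "ereal (f k u) < c k" by auto
        obtain v where "v \<in> {0<..<1}" "ereal (f k v) < c k" "\<bar>v - b\<bar> < b - x"
          using inner[of b k "b - x"] b k x by auto
        then have v: "x < v" "v < 1" "ereal (f k v) < c k" by auto
        have "x \<in> closed_segment u v"
          using u v by (simp add: closed_segment_eq_real_ivl)
        then obtain t where t: "0 \<le> t" "t \<le> 1" "x = (1 - t) *\<^sub>R u + t *\<^sub>R v"
          by (auto simp: closed_segment_def)
        have "f k x \<le> (1 - t) * f k u + t * f k v"
          unfolding t(3) using conv[OF k] t(1,2) u v x by (intro convex_onD) auto
        also have "\<dots> \<le> (1 - t) * max (f k u) (f k v) + t * max (f k u) (f k v)"
          using t by (intro add_mono mult_left_mono) auto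
        also have "\<dots> = max (f k u) (f k v)"
          by (simp add: algebra_simps)
        finally have "ereal (f k x) \<le> max (ereal (f k u)) (ereal (f k v))"
          by (auto simp: max_def split: if_splits)
        also have "\<dots> < c k"
          using u v by simp
        finally show ?thesis .
      qed
      then show ?thesis
        using x by (auto simp: boundary_ext_def)
    qed
  qed
qed

section \<open>The integrated families at the sample average\<close>

text \<open>Takes the place of the inequality between arithmetic and geometric means: each factor is
  at most \<open>exp (y i - 1)\<close>, and the exponents sum to at most 0.\<close>

lemma prod_le_1_if_sum_le_card:
  fixes y :: "'i \<Rightarrow> real"
  assumes "\<And>i. i \<in> I \<Longrightarrow> 0 \<le> y i" "(\<Sum>i\<in>I. y i) \<le> card I"
  shows "(\<Prod>i\<in>I. y i) \<le> 1"
proof (cases "finite I")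
  case True
  have "(\<Prod>i\<in>I. y i) \<le> (\<Prod>i\<in>I. exp (y i - 1))"
    using assms(1) exp_ge_add_one_self[of "y _ - 1"] by (intro prod_mono) auto
  also have "\<dots> = exp ((\<Sum>i\<in>I. y i) - card I)"
    using True by (simp add: sum_subtractf flip: exp_sum)
  also have "\<dots> \<le> 1"
    using assms(2) by simp
  finally show ?thesis .
\<comment> \<open>Over an infinite index set the product is 1 by convention.\<close>
qed simp

text \<open>The density may be unbounded, but \<open>g\<close> is bounded on the compact interval,
  so a multiple of the density dominates.\<close>

lemma integrable_continuous_times_density:
  assumes \<pi>: "prob_density_01 \<pi>" and g: "continuous_on {0..1} g"
  shows "set_integrable lborel {0..1} (\<lambda>c. g c * \<pi> c)"
proof -
  have int: "set_integrable lborel {0..1} \<pi>"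
    using \<pi> by (simp add: prob_density_01_def)
  have "bounded (g ` {0..1})"
    using g by (intro compact_imp_bounded compact_continuous_image) auto
  then obtain B where B: "\<And>c. c \<in> {0..1} \<Longrightarrow> norm (g c) \<le> B"
    by (metis bounded_iff imageI)
  have g_meas: "(\<lambda>c. indicator {0..1} c * g c) \<in> borel_measurable lborel"
    using borel_measurable_continuous_on_indicator[OF _ g] by simp
  have \<pi>_meas: "(\<lambda>c. indicator {0..1} c * \<pi> c) \<in> borel_measurable lborel"
    using int by (auto simp: set_integrable_def dest: borel_measurable_integrable)
  show ?thesis
    unfolding set_integrable_def
  proof (rule Bochner_Integration.integrable_bound)
    show "integrable lborel (\<lambda>c. B * (indicator {0..1} c *\<^sub>R \<pi> c))"
      using int by (simp add: set_integrable_def)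
    \<comment> \<open>Neither factor is known to be measurable outside the interval, so the
      indicator is duplicated to give each its own copy.\<close>
    have "(\<lambda>c. indicator {0..1} c *\<^sub>R (g c * \<pi> c))
        = (\<lambda>c. (indicator {0..1} c * g c) * (indicator {0..1} c * \<pi> c))"
      by (auto split: split_indicator)
    also have "\<dots> \<in> borel_measurable lborel"
      using g_meas \<pi>_meas by (rule borel_measurable_times)
    finally show "(\<lambda>c. indicator {0..1} c *\<^sub>R (g c * \<pi> c)) \<in> borel_measurable lborel" .
    have "norm (g c * \<pi> c) \<le> norm (B * \<pi> c)" if "c \<in> {0..1}" for c
      using order_trans[OF B[OF that], of "\<bar>B\<bar>"] by (simp add: abs_mult mult_right_mono)
    then show "AE c in lborel. norm (indicator {0..1} c *\<^sub>R (g c * \<pi> c))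
        \<le> norm (B * (indicator {0..1} c *\<^sub>R \<pi> c))"
      by (intro AE_I2) (simp split: split_indicator)
  qed
qed

lemma integral_times_density_bounds:
  assumes \<pi>: "prob_density_01 \<pi>" and g: "continuous_on {0..1} g"
  shows "(\<And>c. c \<in> {0..1} \<Longrightarrow> g c \<le> b) \<Longrightarrow> (LINT c:{0..1}|lborel. g c * \<pi> c) \<le> b"
    and "(\<And>c. c \<in> {0..1} \<Longrightarrow> b \<le> g c) \<Longrightarrow> b \<le> (LINT c:{0..1}|lborel. g c * \<pi> c)"
proof -
  have int: "set_integrable lborel {0..1} \<pi>" and one: "(LINT c:{0..1}|lborel. \<pi> c) = 1"
    and pos: "\<And>c. c \<in> {0..1} \<Longrightarrow> 0 \<le> \<pi> c"
    using \<pi> by (auto simp: prob_density_01_def)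
  have b: "(LINT c:{0..1}|lborel. b * \<pi> c) = b" "set_integrable lborel {0..1} (\<lambda>c. b * \<pi> c)"
    using int one by auto
  note g\<pi> = integrable_continuous_times_density[OF \<pi> g]
  show "(LINT c:{0..1}|lborel. g c * \<pi> c) \<le> b" if "\<And>c. c \<in> {0..1} \<Longrightarrow> g c \<le> b"
    using set_integral_mono[OF g\<pi> b(2) mult_right_mono[OF that pos]] by (simp only: b(1))
  show "b \<le> (LINT c:{0..1}|lborel. g c * \<pi> c)" if "\<And>c. c \<in> {0..1} \<Longrightarrow> b \<le> g c"
    using set_integral_mono[OF b(2) g\<pi> mult_right_mono[OF that pos]] by (simp only: b(1))
qed

text \<open>Lets estimates for the increasing family be read off from the decreasing one.\<close>

lemma integrated_inc_conv_dec:
  "integrated_inc \<pi> X k \<mu> \<omega> = integrated_dec \<pi> (\<lambda>i \<omega>. 1 - X i \<omega>) k (1 - \<mu>) \<omega>"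
  by (simp add: integrated_inc_def integrated_dec_def)

text \<open>The factors sum to at most \<open>k\<close>. Allowing \<mu> above the sample average
  matters when that average is 0: the bound is then used at parameter 1.\<close>

lemma integrated_dec_le_1:
  assumes "prob_density_01 \<pi>" "0 < \<mu>" and X: "\<And>i. i \<in> {1..k} \<Longrightarrow> 0 \<le> X i \<omega>"
    and "(\<Sum>i=1..k. X i \<omega>) \<le> k * \<mu>"
  shows "integrated_dec \<pi> X k \<mu> \<omega> \<le> 1"
  unfolding integrated_dec_def
proof (rule integral_times_density_bounds(1)[OF assms(1)])
  fix c :: real assume c: "c \<in> {0..1}"
  show "(\<Prod>i=1..k. 1 - c + c * (X i \<omega> / \<mu>)) \<le> 1"
  proof (rule prod_le_1_if_sum_le_card)
    have "(\<Sum>i=1..k. 1 - c + c * (X i \<omega> / \<mu>)) = k * (1 - c) + c * ((\<Sum>i=1..k. X i \<omega>) / \<mu>)"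
      by (simp add: sum.distrib sum_subtractf sum_distrib_left sum_divide_distrib algebra_simps)
    also have "\<dots> \<le> k * (1 - c) + c * k"
      using assms c by (intro add_left_mono mult_left_mono) (auto simp: field_simps)
    finally show "(\<Sum>i=1..k. 1 - c + c * (X i \<omega> / \<mu>)) \<le> real (card {1..k})"
      by (simp add: algebra_simps)
  qed (use X assms(2) c in auto)
qed (use assms(2) in \<open>auto intro!: continuous_intros\<close>)

text \<open>Meant for the sample average 1. For inner \<mu> the integral is then at least 1, so a
  bound by 1 has to come from the limit; it is squeezed between 1 and
  \<open>(1 / \<mu>) ^ k\<close>.\<close>

lemma integrated_dec_ones_tendsto:
  assumes \<pi>: "prob_density_01 \<pi>" and X: "\<And>i. i \<in> {1..k} \<Longrightarrow> X i \<omega> = 1"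
  shows "((\<lambda>\<mu>. integrated_dec \<pi> X k \<mu> \<omega>) \<longlongrightarrow> 1) (at 1 within {0<..<1})"
proof (rule tendsto_sandwich)
  have bounds: "1 \<le> integrated_dec \<pi> X k \<mu> \<omega> \<and> integrated_dec \<pi> X k \<mu> \<omega> \<le> (1 / \<mu>) ^ k"
    if \<mu>: "\<mu> \<in> {0<..<1}" for \<mu>
  proof -
    have "integrated_dec \<pi> X k \<mu> \<omega> = (LINT c:{0..1}|lborel. (1 - c + c * (1 / \<mu>)) ^ k * \<pi> c)"
      by (simp add: integrated_dec_def X)
    moreover have "1 \<le> 1 - c + c * (1 / \<mu>)" "1 - c + c * (1 / \<mu>) \<le> 1 / \<mu>" if c: "c \<in> {0..1}" for c
    proof -
      have "1 \<le> 1 / \<mu>" using \<mu> by simp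
      then have "c * 1 \<le> c * (1 / \<mu>)" "(1 - c) * 1 \<le> (1 - c) * (1 / \<mu>)"
        by (rule mult_left_mono, use c in simp)+
      then show "1 \<le> 1 - c + c * (1 / \<mu>)" "1 - c + c * (1 / \<mu>) \<le> 1 / \<mu>"
        unfolding left_diff_distrib by linarith+
    qed
    then have "1 \<le> (1 - c + c * (1 / \<mu>)) ^ k" "(1 - c + c * (1 / \<mu>)) ^ k \<le> (1 / \<mu>) ^ k"
      if "c \<in> {0..1}" for c
      using that one_le_power[of "1 - c + c * (1 / \<mu>)" k]
        power_mono[of "1 - c + c * (1 / \<mu>)" "1 / \<mu>" k] order_trans[OF zero_le_one]
      by blast+
    moreover have "continuous_on {0..1} (\<lambda>c. (1 - c + c * (1 / \<mu>)) ^ k)"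
      by (intro continuous_intros)
    ultimately show ?thesis
      using integral_times_density_bounds[OF \<pi>, of "\<lambda>c. (1 - c + c * (1 / \<mu>)) ^ k"]
      by presburger
  qed
  have "eventually (\<lambda>\<mu>::real. \<mu> \<in> {0<..<1}) (at 1 within {0<..<1})"
    by (auto simp: eventually_at_filter)
  then show "eventually (\<lambda>\<mu>. 1 \<le> integrated_dec \<pi> X k \<mu> \<omega>) (at 1 within {0<..<1})"
    "eventually (\<lambda>\<mu>. integrated_dec \<pi> X k \<mu> \<omega> \<le> (1 / \<mu>) ^ k) (at 1 within {0<..<1})"
    by (rule eventually_mono, use bounds in blast)+
  have "((\<lambda>\<mu>::real. (1 / \<mu>) ^ k) \<longlongrightarrow> (1 / 1) ^ k) (at 1 within {0<..<1})"
    by (intro tendsto_intros) auto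
  then show "((\<lambda>\<mu>::real. (1 / \<mu>) ^ k) \<longlongrightarrow> 1) (at 1 within {0<..<1})"
    by simp
qed simp

text \<open>The parameter only occurs as a divisor of 0, and it drops out even when it is 0 itself,
  because \<open>0 / 0 = 0\<close>.\<close>

lemma integrated_dec_zeros:
  "(\<And>i. i \<in> {1..k} \<Longrightarrow> X i \<omega> = 0) \<Longrightarrow> integrated_dec \<pi> X k \<mu> \<omega> = integrated_dec \<pi> X k \<nu> \<omega>"
  by (simp add: integrated_dec_def)

lemma integrated_inc_ones_tendsto:
  assumes "prob_density_01 \<pi>" "\<And>i. i \<in> {1..k} \<Longrightarrow> X i \<omega> = 0"
  shows "((\<lambda>\<mu>. integrated_inc \<pi> X k \<mu> \<omega>) \<longlongrightarrow> 1) (at 0 within {0<..<1})"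
proof -
  have "((\<lambda>\<mu>. integrated_dec \<pi> (\<lambda>i \<omega>. 1 - X i \<omega>) k \<mu> \<omega>) \<longlongrightarrow> 1) (at 1 within {0<..<1})"
    using assms by (intro integrated_dec_ones_tendsto) auto
  moreover have "filterlim (\<lambda>\<mu>::real. 1 - \<mu>) (at 1 within {0<..<1}) (at 0 within {0<..<1})"
    unfolding filterlim_at
  proof
    show "eventually (\<lambda>\<mu>::real. 1 - \<mu> \<in> {0<..<1} \<and> 1 - \<mu> \<noteq> 1) (at 0 within {0<..<1})"
      by (auto simp: eventually_at_filter)
    have "((\<lambda>\<mu>::real. 1 - \<mu>) \<longlongrightarrow> 1 - 0) (at 0 within {0<..<1})"
      by (intro tendsto_intros)
    then show "((\<lambda>\<mu>::real. 1 - \<mu>) \<longlongrightarrow> 1) (at 0 within {0<..<1})"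
      by simp
  qed
  ultimately show ?thesis
    unfolding integrated_inc_conv_dec by (rule filterlim_compose)
qed

lemma boundary_ext_mixed_integrated_le_1:
  fixes X :: "nat \<Rightarrow> 'w \<Rightarrow> real"
  assumes \<pi>: "prob_density_01 \<pi>_dec" "prob_density_01 \<pi>_inc"
    and pq: "0 \<le> p" "0 \<le> q" "p + q = 1"
    and X: "\<And>i. i \<in> {1..k} \<Longrightarrow> X i \<omega> \<in> {0..1}" and k: "1 \<le> k"
  defines "t \<equiv> (\<Sum>i=1..k. X i \<omega>) / real k"
  shows "t \<in> {0..1}"
    and "boundary_ext
      (\<lambda>\<nu>. mixed_family p q (integrated_dec \<pi>_dec X) (integrated_inc \<pi>_inc X) k \<nu> \<omega>) t \<le> 1"
proof -
  let ?D = "\<lambda>\<nu>. integrated_dec \<pi>_dec X k \<nu> \<omega>" and ?I = "\<lambda>\<nu>. integrated_inc \<pi>_inc X k \<nu> \<omega>"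
  let ?X' = "\<lambda>i \<omega>. 1 - X i \<omega>"
  have sum: "(\<Sum>i=1..k. X i \<omega>) = k * t" "(\<Sum>i=1..k. 1 - X i \<omega>) = k * (1 - t)"
    using k by (auto simp: t_def sum_subtractf field_simps)
  have "0 \<le> (\<Sum>i=1..k. X i \<omega>)" "0 \<le> (\<Sum>i=1..k. 1 - X i \<omega>)"
    using X by (auto intro!: sum_nonneg)
  then show t: "t \<in> {0..1}"
    using k unfolding sum by (auto simp: zero_le_mult_iff)
  have D_le: "?D \<nu> \<le> 1" if "t \<le> \<nu>" "0 < \<nu>" for \<nu>
    using X that k sum(1) by (intro integrated_dec_le_1 \<pi>) auto
  have I_le: "?I \<nu> \<le> 1" if "\<nu> \<le> t" "\<nu> < 1" for \<nu>
    unfolding integrated_inc_conv_dec using X that k sum(2)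
    by (intro integrated_dec_le_1 \<pi>) auto
  have convex_le: "p * d + q * i \<le> 1" if "d \<le> 1" "i \<le> 1" for d i
    using convex_bound_le[OF that pq] .
  show "boundary_ext
      (\<lambda>\<nu>. mixed_family p q (integrated_dec \<pi>_dec X) (integrated_inc \<pi>_inc X) k \<nu> \<omega>) t \<le> 1"
  proof (cases "t = 0 \<or> t = 1")
    case False
    then show ?thesis
      using t convex_le[OF D_le[of t] I_le[of t]] by (auto simp: boundary_ext_def mixed_family_def)
  next
    case True
    \<comment> \<open>If the average is 0 or 1, all observations equal it. One of the two integrals
      is then constant in the parameter and the other tends to 1, so both limits are finite.\<close>
    have "\<exists>d i. d \<le> 1 \<and> i \<le> 1 \<and> (?D \<longlongrightarrow> d) (at t within {0<..<1}) \<and> (?I \<longlongrightarrow> i) (at t within {0<..<1})"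
      using True
    proof
      assume t: "t = 0"
      then have zero: "X i \<omega> = 0" if "i \<in> {1..k}" for i
        using sum_nonneg_eq_0_iff[of "{1..k}" "\<lambda>i. X i \<omega>"] sum(1) X t that by auto
      then have "?D \<nu> = ?D 1" for \<nu>
        by (rule integrated_dec_zeros)
      then have "(?D \<longlongrightarrow> ?D 1) (at 0 within {0<..<1})"
        by (intro tendsto_eventually always_eventually allI)
      moreover have "(?I \<longlongrightarrow> 1) (at 0 within {0<..<1})"
        using zero by (intro integrated_inc_ones_tendsto \<pi>) auto
      ultimately show ?thesis
        unfolding t using D_le[of 1] t by (intro exI[of _ "?D 1"] exI[of _ 1] conjI) auto
    next
      assume t: "t = 1"
      then have zero: "1 - X i \<omega> = 0" if "i \<in> {1..k}" for i
        using sum_nonneg_eq_0_iff[of "{1..k}" "\<lambda>i. 1 - X i \<omega>"] sum(2) X t that by auto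
      then have "?I \<nu> = ?I 0" for \<nu>
        unfolding integrated_inc_conv_dec by (rule integrated_dec_zeros)
      then have "(?I \<longlongrightarrow> ?I 0) (at 1 within {0<..<1})"
        by (intro tendsto_eventually always_eventually allI)
      moreover have "(?D \<longlongrightarrow> 1) (at 1 within {0<..<1})"
        using zero by (intro integrated_dec_ones_tendsto \<pi>) auto
      ultimately show ?thesis
        unfolding t using I_le[of 0] t by (intro exI[of _ 1] exI[of _ "?I 0"] conjI) auto
    qed
    then obtain d i where di: "d \<le> 1" "i \<le> 1"
      and lim: "(?D \<longlongrightarrow> d) (at t within {0<..<1})" "(?I \<longlongrightarrow> i) (at t within {0<..<1})"
      by blast
    have "boundary_ext (\<lambda>\<nu>. p * ?D \<nu> + q * ?I \<nu>) t = ereal (p * d + q * i)"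
      by (intro boundary_ext_eqI True tendsto_ereal tendsto_intros lim)
    then show ?thesis
      using convex_le[OF di] by (simp add: mixed_family_def)
  qed
qed

section \<open>The mixed family: supermartingale, convexity, coverage and sample average\<close>

theorem theorem11:
  fixes S :: "'w measure" and PP :: "'w measure set" and F :: "nat \<Rightarrow> 'w measure"
    and T :: "'w \<Rightarrow> real" and X :: "nat \<Rightarrow> 'w \<Rightarrow> real"
    and M_dec M_inc :: "nat \<Rightarrow> real \<Rightarrow> 'w \<Rightarrow> real"
    and p_dec p_inc :: real
  assumes "sampling_model S PP T X"
    and "filtration_on S F"
    and "convex_decreasing_family S PP F T X M_dec"
    and "convex_increasing_family S PP F T X M_inc"
    and "0 \<le> p_dec" and "0 \<le> p_inc" and "p_dec + p_inc = 1"
  defines "M \<equiv> mixed_family p_dec p_inc M_dec M_inc"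
  shows
    "(\<forall>\<mu>. 0 < \<mu> \<and> \<mu> < 1 \<longrightarrow>
        test_supermartingale {P \<in> PP. prob_space.expectation P T = \<mu>} F (\<lambda>k. M k \<mu>)) \<and>
     (\<forall>k. \<forall>\<omega>\<in>realizations S X. convex_on {0<..<1} (\<lambda>\<mu>. M k \<mu> \<omega>)) \<and>
     (\<forall>\<alpha>. 0 < \<alpha> \<and> \<alpha> < 1 \<and>
        (\<forall>P\<in>PP. \<forall>\<mu>>0. prob_space.expectation P T \<le> \<mu> \<longrightarrow>
           prob_space.expectation P (M_dec 0 \<mu>) \<le> 1) \<and>
        (\<forall>P\<in>PP. \<forall>\<mu><1. prob_space.expectation P T \<ge> \<mu> \<longrightarrow>
           prob_space.expectation P (M_inc 0 \<mu>) \<le> 1) \<longrightarrow>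
        confidence_interval S PP T X (1 - \<alpha>) (confidence_region M \<alpha> UNIV) \<and>
        (\<forall>k. confidence_interval S PP T X (1 - \<alpha>) (confidence_region M \<alpha> {..k}) \<and>
             confidence_interval S PP T X (1 - \<alpha>) (confidence_region M \<alpha> {k}))) \<and>
     (\<forall>\<pi>_dec \<pi>_inc \<alpha>. prob_density_01 \<pi>_dec \<and> prob_density_01 \<pi>_inc \<and> 0 < \<alpha> \<and> \<alpha> < 1 \<longrightarrow>
        (\<forall>k\<ge>1. \<forall>\<omega>\<in>realizations S X.
           (\<Sum>i=1..k. X i \<omega>) / real k \<in>
             confidence_region
               (mixed_family p_dec p_inc (integrated_dec \<pi>_dec X) (integrated_inc \<pi>_inc X))
               \<alpha> {k} \<omega>))"
proof -
  note model = assms(1,2) and pq = assms(5-7)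
  have dec: "\<And>\<mu>. 0 < \<mu> \<Longrightarrow>
      test_supermartingale {P \<in> PP. prob_space.expectation P T \<le> \<mu>} F (\<lambda>k. M_dec k \<mu>)"
    "\<And>k \<omega>. \<omega> \<in> realizations S X \<Longrightarrow> antimono_on {0<..} (\<lambda>\<mu>. M_dec k \<mu> \<omega>)"
    "\<And>k \<omega>. \<omega> \<in> realizations S X \<Longrightarrow> continuous_on {0<..} (\<lambda>\<mu>. M_dec k \<mu> \<omega>)"
    "\<And>k \<omega>. \<omega> \<in> realizations S X \<Longrightarrow> convex_on {0<..} (\<lambda>\<mu>. M_dec k \<mu> \<omega>)"
    using assms(3) by (auto simp: convex_decreasing_family_def decreasing_family_def)
  have "increasing_family S PP F T X M_inc"
    and inc_convex: "\<And>k \<omega>. \<omega> \<in> realizations S X \<Longrightarrow> convex_on {..<1} (\<lambda>\<mu>. M_inc k \<mu> \<omega>)"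
    using assms(4) by (auto simp: convex_increasing_family_def)
  note inc = increasing_familyD[OF assms(1) this(1)]
  have M: "M k \<mu> = (\<lambda>\<omega>. p_dec * M_dec k \<mu> \<omega> + p_inc * M_inc k \<mu> \<omega>)" for k \<mu>
    by (auto simp: M_def mixed_family_def)

  have mixed_test: "test_supermartingale {P \<in> PP. prob_space.expectation P T = \<mu>} F
      (\<lambda>k \<omega>. p_dec * M_dec k \<mu>1 \<omega> + p_inc * M_inc k \<mu>2 \<omega>)"
    if "\<mu> \<le> \<mu>1" "0 < \<mu>1" "\<mu>2 \<le> \<mu>" "\<mu>2 < 1" for \<mu> \<mu>1 \<mu>2
    using that
    by (intro test_supermartingale_lincomb[OF model] pq
        test_supermartingale_subset[OF dec(1)[of \<mu>1]] test_supermartingale_subset[OF inc(1)[of \<mu>2]])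
      auto

  have convex: "convex_on {0<..<1} (\<lambda>\<mu>. M k \<mu> \<omega>)" if \<omega>: "\<omega> \<in> realizations S X" for k \<omega>
    unfolding M
    by (intro convex_on_add convex_on_cmul pq convex_on_subset[OF dec(4)[OF \<omega>]]
        convex_on_subset[OF inc_convex[OF \<omega>]]) auto

  \<comment> \<open>The nonnegative weights are absorbed into the functions. This preserves
    monotonicity and continuity, also for a weight 0.\<close>
  let ?f = "\<lambda>k \<omega> \<mu>. p_dec * M_dec k \<mu> \<omega>" and ?g = "\<lambda>k \<omega> \<mu>. p_inc * M_inc k \<mu> \<omega>"
  have f: "antimono_on {0<..} (?f k \<omega>)" "continuous_on {0<..} (?f k \<omega>)"
    and g: "mono_on {..<1} (?g k \<omega>)" "continuous_on {..<1} (?g k \<omega>)"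
    if "\<omega> \<in> realizations S X" for k \<omega>
    using dec(2,3)[OF that, of k] inc(2,3)[OF that, of k] pq
    by (auto simp: monotone_on_def intro!: mult_left_mono continuous_on_mult_left)
  have ext: "boundary_ext (\<lambda>\<nu>. M k \<nu> \<omega>) \<mu> = (SUP n. ereal (inner_approx (?f k \<omega>) (?g k \<omega>) \<mu> n))"
    if "\<omega> \<in> realizations S X" "\<mu> \<in> {0..1}" for k \<omega> \<mu>
    unfolding M using that f g by (intro boundary_ext_SUP_inner_approx) auto

  \<comment> \<open>A general set \<open>K\<close> of times covers all three regions:
    \<open>UNIV\<close>, \<open>{..k}\<close> and \<open>{k}\<close>.\<close>
  have region: "confidence_interval S PP T X (1 - \<alpha>) (confidence_region M \<alpha> K)"
    if \<alpha>: "0 < \<alpha>"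
      and init_dec: "\<And>P \<mu>. P \<in> PP \<Longrightarrow> 0 < \<mu> \<Longrightarrow> prob_space.expectation P T \<le> \<mu> \<Longrightarrow>
        prob_space.expectation P (M_dec 0 \<mu>) \<le> 1"
      and init_inc: "\<And>P \<mu>. P \<in> PP \<Longrightarrow> \<mu> < 1 \<Longrightarrow> \<mu> \<le> prob_space.expectation P T \<Longrightarrow>
        prob_space.expectation P (M_inc 0 \<mu>) \<le> 1"
    for \<alpha> K
    unfolding confidence_interval_def
  proof (intro conjI ballI)
    fix \<omega> assume \<omega>: "\<omega> \<in> realizations S X"
    show "is_interval (confidence_region M \<alpha> K \<omega>)"
      unfolding confidence_region_def
    proof (rule is_interval_boundary_ext_less)
      show "convex_on {0<..<1} (\<lambda>\<mu>. M k \<mu> \<omega>)" for k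
        using \<omega> by (rule convex)
      show "((\<lambda>\<nu>. ereal (M k \<nu> \<omega>)) \<longlongrightarrow> boundary_ext (\<lambda>\<nu>. M k \<nu> \<omega>) \<mu>) (at \<mu> within {0<..<1})"
        if "\<mu> = 0 \<or> \<mu> = 1" for k \<mu>
        using tendsto_inner_approx[OF that f[OF \<omega>] g[OF \<omega>], of k k] ext[OF \<omega>, of \<mu> k] that
        by (auto simp: M)
    qed
  next
    fix P assume P: "P \<in> PP"
    define \<mu> where "\<mu> = prob_space.expectation P T"
    have \<mu>: "\<mu> \<in> {0..1}"
      unfolding \<mu>_def using mean_in_unit_interval[OF assms(1) P] by blast
    have prob: "prob_space P" and sets: "sets P = sets S"
      using assms(1) P by (auto simp: sampling_model_def)
    have filt: "filtration_on P F"
      using model(2) sets sets_eq_imp_space_eq[OF sets]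
      by (auto simp: filtration_on_def subalgebra_def)
    let ?\<mu>1 = "\<lambda>n. max \<mu> (1 / real (n + 2))" and ?\<mu>2 = "\<lambda>n. min \<mu> (1 - 1 / real (n + 2))"
    have \<mu>12: "\<mu> \<le> ?\<mu>1 n" "0 < ?\<mu>1 n" "?\<mu>2 n \<le> \<mu>" "?\<mu>2 n < 1" for n
      by (auto simp: less_max_iff_disj min_less_iff_disj)
    let ?Y = "\<lambda>n k \<omega>. inner_approx (?f k \<omega>) (?g k \<omega>) \<mu> n"
    have test: "supermartingale P F (?Y n)" "AE \<omega> in P. 0 \<le> ?Y n k \<omega>" for n k
      using mixed_test[OF \<mu>12(1,2)[of n] \<mu>12(3,4)[of n]] P
      by (auto simp: inner_approx_def test_supermartingale_def \<mu>_def)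
    have "1 - \<alpha> \<le> measure P
        {\<omega> \<in> realizations S X. \<forall>k\<in>K. (SUP n. ereal (?Y n k \<omega>)) < ereal (1 / \<alpha>)}"
    proof (rule coverage_SUP_supermartingales[OF prob filt test])
      \<comment> \<open>The bounds on the initial means hold at every parameter whose hypothesis
        \<open>P\<close> satisfies, hence at the shifted ones, and they pass to the convex
        combination.\<close>
      show "prob_space.expectation P (?Y n 0) \<le> 1" for n
      proof -
        have "test_supermartingale {P} F (\<lambda>k. M_dec k (?\<mu>1 n))"
          using P \<mu>12(1)[of n] by (intro test_supermartingale_subset[OF dec(1)[OF \<mu>12(2)[of n]]])
            (auto simp: \<mu>_def)
        moreover have "test_supermartingale {P} F (\<lambda>k. M_inc k (?\<mu>2 n))"
          using P \<mu>12(3)[of n] by (intro test_supermartingale_subset[OF inc(1)[OF \<mu>12(4)[of n]]])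
            (auto simp: \<mu>_def)
        ultimately have "prob_space.expectation P (?Y n 0) =
            p_dec * prob_space.expectation P (M_dec 0 (?\<mu>1 n)) +
            p_inc * prob_space.expectation P (M_inc 0 (?\<mu>2 n))"
          by (simp add: inner_approx_def test_supermartingale_def supermartingale_def)
        also have "\<dots> \<le> 1"
          using \<mu>12[of n] P by (intro convex_bound_le pq init_dec init_inc) (simp_all only: \<mu>_def)
        finally show ?thesis .
      qed
      show "realizations S X \<in> sets P"
        unfolding sets using assms(1) by (rule realizations_in_sets)
      show "AE \<omega> in P. \<omega> \<in> realizations S X"
        using assms(1) P by (rule AE_realizations)
      show "incseq (\<lambda>n. ?Y n k \<omega>)" if "\<omega> \<in> realizations S X" for k \<omega>
        using inner_approx_mono[OF f(1) g(1), OF that that] .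
    qed (rule \<alpha>)
    also have "{\<omega> \<in> realizations S X. \<forall>k\<in>K. (SUP n. ereal (?Y n k \<omega>)) < ereal (1 / \<alpha>)}
        = {\<omega> \<in> realizations S X. prob_space.expectation P T \<in> confidence_region M \<alpha> K \<omega>}"
      using \<mu> ext[OF _ \<mu>] unfolding confidence_region_def \<mu>_def[symmetric] by auto
    finally show "1 - \<alpha> \<le> measure P
        {\<omega> \<in> realizations S X. prob_space.expectation P T \<in> confidence_region M \<alpha> K \<omega>}" .
  qed

  have average: "(\<Sum>i=1..k. X i \<omega>) / real k \<in> confidence_region
      (mixed_family p_dec p_inc (integrated_dec \<pi>_dec X) (integrated_inc \<pi>_inc X)) \<alpha> {k} \<omega>"
    if "prob_density_01 \<pi>_dec" "prob_density_01 \<pi>_inc" "0 < \<alpha>" "\<alpha> < 1" "1 \<le> k"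
      and \<omega>: "\<omega> \<in> realizations S X" for \<pi>_dec \<pi>_inc \<alpha> k \<omega>
  proof -
    have "X i \<omega> \<in> {0..1}" if "i \<in> {1..k}" for i
      using \<omega> that by (auto simp: realizations_def)
    note boundary_ext_mixed_integrated_le_1[of \<pi>_dec \<pi>_inc p_dec p_inc k X \<omega>,
        OF that(1,2) pq this that(5)]
    \<comment> \<open>Here \<open>\<alpha> < 1\<close> turns the bound by 1 into the strict
      inequality that defines the region.\<close>
    moreover have "1 < ereal (1 / \<alpha>)"
      using that by (simp add: one_ereal_def)
    ultimately show ?thesis
      unfolding confidence_region_def by (auto intro: order_le_less_trans)
  qed

  have "test_supermartingale {P \<in> PP. prob_space.expectation P T = \<mu>} F (\<lambda>k. M k \<mu>)"
    if "0 < \<mu>" "\<mu> < 1" for \<mu>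
    unfolding M using that by (intro mixed_test) auto
  with convex region average show ?thesis
    by (intro conjI allI impI ballI) blast+
qed

end
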